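(* Consider the generalized Riemann problem for the 1D ten-moment equations with source in the acoustic case. Then $$\left(\tfrac{\partial u_1}{\partial t}\right)_\ast=\frac1{2c_\ast}\left[\left(-\frac{p_{11,L}'}{\rho_\ast}-c_\ast u_{1,L}'-\tfrac12W_x(0)\right)(u_{1,\ast}+c_\ast)+\left(\frac{p_{11,R}'}{\rho_\ast}-c_\ast u_{1,R}'+\tfrac12W_x(0)\right)(u_{1,\ast}-c_\ast)\right],$$ $$\left(\tfrac{\partial p_{11}}{\partial t}\right)_\ast=-\frac{\rho_\ast c_\ast}2\left[\left(u_{1,L}'+\frac{p_{11,L}'}{\rho_\ast c_\ast}\right)(u_{1,\ast}+c_\ast)-\left(u_{1,R}'-\frac{p_{11,R}'}{\rho_\ast c_\ast}\right)(u_{1,\ast}-c_\ast)\right],$$ and $$\left(\tfrac{\partial\rho}{\partial t}\right)_{\ast K}=\frac1{c_\ast^2}\left[\left(\tfrac{\partial p_{11}}{\partial t}\right)_\ast+u_{1,\ast}(p_{11,K}'-c_\ast^2\rho_K')\right],\qquad K=L,R.$$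
   Context: **System.** $\mathbf V=(\rho,u_1,u_2,p_{11},p_{12},p_{22})^\top$ with $\rho>0$, $p_{11}>0$, $p_{11}p_{22}-p_{12}^2>0$; $W(x)$ is a given $C^1$ potential; $c=\sqrt{3p_{11}/\rho}$; $\frac{\mathcal D}{\mathcal D t}=\partial_t+u_1\partial_x$. Smooth solutions satisfy: $\frac{\mathcal D\rho}{\mathcal D t}+\rho\partial_xu_1=0$; $\frac{\mathcal D u_1}{\mathcal D t}+\frac1\rho\partial_xp_{11}=-\frac12W_x$; $\frac{\mathcal D u_2}{\mathcal D t}+\frac1\rho\partial_xp_{12}=0$; $\frac{\mathcal D p_{11}}{\mathcal D t}+3p_{11}\partial_xu_1=0$; $\frac{\mathcal D p_{12}}{\mathcal D t}+2p_{12}\partial_xu_1+p_{11}\partial_xu_2=0$; $\frac{\mathcal D p_{22}}{\mathcal D t}+p_{22}\partial_xu_1+2p_{12}\partial_xu_2=0$. **Generalized Riemann problem, acoustic case.** Initial data $\mathbf V_L+x\mathbf V_L'$ for $x<0$, $\mathbf V_R+x\mathbf V_R'$ for $x>0$, with constant vectors $\mathbf V_K=(\rho_K,u_{1,K},u_{2,K},p_{11,K},p_{12,K},p_{22,K})^\top$, $\mathbf V_K'=(\rho_K',u_{1,K}',u_{2,K}',p_{11,K}',p_{12,K}',p_{22,K}')^\top$, where $\mathbf V_L=\mathbf V_R=:\mathbf V_\ast=(\rho_\ast,u_{1,\ast},u_{2,\ast},p_{11,\ast},p_{12,\ast},p_{22,\ast})^\top$ but $\mathbf V_L'\neq\mathbf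 V_R'$; $c_\ast=\sqrt{3p_{11,\ast}/\rho_\ast}$. Only linear (acoustic) waves leave the origin: the solution is continuous near $(0,0)$, $0\le t\ll1$, and smooth (with derivatives having limits at $(0,0)$) in the regions separated by smooth characteristic curves from the origin with speeds $u_1-c$ (1-wave), $u_1-\frac c{\sqrt3}$ (2-wave), $u_1$ (contact), $u_1+\frac c{\sqrt3}$ (5-wave), $u_1+c$ (6-wave). The four regions between consecutive curves are, from left to right, $\ast L,\ast\ast L,\ast\ast R,\ast R$; a region subscript denotes the limit at $(0,0)$ from that region. Limits of $\partial_tu_1,\partial_tp_{11}$ are the same in all four regions and carry the subscript $\ast$; $(\partial_t\rho)_{\ast K}$ is the common limit in $\ast K$ and $\ast\ast K$. *)

theory Defs
  imports "HOL-Analysis.Analysis"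
begin

text \<open>
  A state is \<open>(rho, u1, u2, p11, p12, p22)\<close>, and points of the half plane are pairs \<open>(t, x)\<close>,
  time first.
\<close>

type_synonym state = "real ^ 6"

definition rho :: "state \<Rightarrow> real" where "rho v = v $ 1"
definition u1 :: "state \<Rightarrow> real" where "u1 v = v $ 2"
definition u2 :: "state \<Rightarrow> real" where "u2 v = v $ 3"
definition p11 :: "state \<Rightarrow> real" where "p11 v = v $ 4"
definition p12 :: "state \<Rightarrow> real" where "p12 v = v $ 5"
definition p22 :: "state \<Rightarrow> real" where "p22 v = v $ 6"

definition admissible :: "state \<Rightarrow> bool" where
  "admissible v \<longleftrightarrow> rho v > 0 \<and> p11 v > 0 \<and> p11 v * p22 v - (p12 v)\<^sup>2 > 0"

definition sound_speed :: "state \<Rightarrow> real" where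
  "sound_speed v = sqrt (3 * p11 v / rho v)"

definition partial_t :: "(real \<times> real \<Rightarrow> 'a::real_normed_vector) \<Rightarrow> real \<times> real \<Rightarrow> 'a" where
  "partial_t f z = vector_derivative (\<lambda>s. f (s, snd z)) (at (fst z))"

definition partial_x :: "(real \<times> real \<Rightarrow> 'a::real_normed_vector) \<Rightarrow> real \<times> real \<Rightarrow> 'a" where
  "partial_x f z = vector_derivative (\<lambda>y. f (fst z, y)) (at (snd z))"

text \<open>Only used for open sets \<open>S\<close>.\<close>

definition C1_in :: "(real \<times> real) set \<Rightarrow> (real \<times> real \<Rightarrow> 'a::real_normed_vector) \<Rightarrow> bool" where
  "C1_in S f \<longleftrightarrow>
     (\<forall>(t, x) \<in> S. (\<lambda>s. f (s, x)) differentiable (at t) \<and> (\<lambda>y. f (t, y)) differentiable (at x)) \<and>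
     continuous_on S (partial_t f) \<and> continuous_on S (partial_x f)"

definition material :: "(real \<times> real \<Rightarrow> state) \<Rightarrow> (state \<Rightarrow> real) \<Rightarrow> real \<times> real \<Rightarrow> real" where
  "material V q z = partial_t (\<lambda>z. q (V z)) z + u1 (V z) * partial_x (\<lambda>z. q (V z)) z"

definition ten_moment_at :: "(real \<Rightarrow> real) \<Rightarrow> (real \<times> real \<Rightarrow> state) \<Rightarrow> real \<times> real \<Rightarrow> bool" where
  "ten_moment_at W V z \<longleftrightarrow>
     (let u1x = partial_x (\<lambda>z. u1 (V z)) z;
          u2x = partial_x (\<lambda>z. u2 (V z)) z;
          p11x = partial_x (\<lambda>z. p11 (V z)) z;
          p12x = partial_x (\<lambda>z. p12 (V z)) z
      in material V rho z + rho (V z) * u1x = 0 \<and>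
         material V u1 z + p11x / rho (V z) = - (1 / 2) * deriv W (snd z) \<and>
         material V u2 z + p12x / rho (V z) = 0 \<and>
         material V p11 z + 3 * p11 (V z) * u1x = 0 \<and>
         material V p12 z + 2 * p12 (V z) * u1x + p11 (V z) * u2x = 0 \<and>
         material V p22 z + p22 (V z) * u1x + 2 * p12 (V z) * u2x = 0)"

text \<open>The eigenvalue \<open>u1\<close> is double; the contact carries the indices 3 and 4.\<close>

datatype wave = Wave1 | Wave2 | Contact | Wave5 | Wave6

fun char_speed :: "wave \<Rightarrow> state \<Rightarrow> real" where
  "char_speed Wave1 v = u1 v - sound_speed v"
| "char_speed Wave2 v = u1 v - sound_speed v / sqrt 3"
| "char_speed Contact v = u1 v"
| "char_speed Wave5 v = u1 v + sound_speed v / sqrt 3"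
| "char_speed Wave6 v = u1 v + sound_speed v"

text \<open>
  The solution is considered on \<open>0 \<le> t < T\<close>, \<open>\<bar>x\<bar> < r\<close>, and \<open>X w\<close> is the curve \<open>x = X w t\<close> of
  wave \<open>w\<close>. The six open sectors cut out of \<open>0 < t < T\<close>, \<open>\<bar>x\<bar> < r\<close> by the five curves are, from
  left to right:
\<close>

datatype region = Outer_L | Star_L | StarStar_L | StarStar_R | Star_R | Outer_R

fun sector :: "real \<Rightarrow> real \<Rightarrow> (wave \<Rightarrow> real \<Rightarrow> real) \<Rightarrow> region \<Rightarrow> (real \<times> real) set" where
  "sector T r X Outer_L = {(t, x). 0 < t \<and> t < T \<and> - r < x \<and> x < X Wave1 t}"
| "sector T r X Star_L = {(t, x). 0 < t \<and> t < T \<and> X Wave1 t < x \<and> x < X Wave2 t}"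
| "sector T r X StarStar_L = {(t, x). 0 < t \<and> t < T \<and> X Wave2 t < x \<and> x < X Contact t}"
| "sector T r X StarStar_R = {(t, x). 0 < t \<and> t < T \<and> X Contact t < x \<and> x < X Wave5 t}"
| "sector T r X Star_R = {(t, x). 0 < t \<and> t < T \<and> X Wave5 t < x \<and> x < X Wave6 t}"
| "sector T r X Outer_R = {(t, x). 0 < t \<and> t < T \<and> X Wave6 t < x \<and> x < r}"

text \<open>
  Along the curves continuity of \<open>V\<close> makes the right-hand side of the characteristic equation
  continuous, so the curves are automatically continuously differentiable up to \<open>t = 0\<close>.
\<close>

definition wave_curves ::
    "(real \<times> real \<Rightarrow> state) \<Rightarrow> real \<Rightarrow> real \<Rightarrow> (wave \<Rightarrow> real \<Rightarrow> real) \<Rightarrow> bool" where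
  "wave_curves V T r X \<longleftrightarrow>
     (\<forall>w. X w 0 = 0) \<and>
     (\<forall>w. \<forall>t\<in>{0..<T}. \<bar>X w t\<bar> < r \<and>
        (X w has_real_derivative char_speed w (V (t, X w t))) (at t within {0..<T})) \<and>
     (\<forall>t\<in>{0<..<T}. X Wave1 t < X Wave2 t \<and> X Wave2 t < X Contact t \<and>
        X Contact t < X Wave5 t \<and> X Wave5 t < X Wave6 t)"

definition GRP_initial_data ::
    "state \<Rightarrow> state \<Rightarrow> state \<Rightarrow> state \<Rightarrow> (real \<times> real \<Rightarrow> state) \<Rightarrow> real \<Rightarrow> bool" where
  "GRP_initial_data VL VL' VR VR' V r \<longleftrightarrow>
     (\<forall>x. - r < x \<and> x < 0 \<longrightarrow> V (0, x) = VL + x *\<^sub>R VL') \<and>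
     (\<forall>x. 0 < x \<and> x < r \<longrightarrow> V (0, x) = VR + x *\<^sub>R VR')"

definition acoustic_wave_solution ::
    "(real \<Rightarrow> real) \<Rightarrow> (real \<times> real \<Rightarrow> state) \<Rightarrow> real \<Rightarrow> real \<Rightarrow> (wave \<Rightarrow> real \<Rightarrow> real) \<Rightarrow> bool" where
  "acoustic_wave_solution W V T r X \<longleftrightarrow>
     0 < T \<and> 0 < r \<and>
     continuous_on ({0..<T} \<times> {-r<..<r}) V \<and>
     (\<forall>z \<in> {0..<T} \<times> {-r<..<r}. admissible (V z)) \<and>
     wave_curves V T r X \<and>
     (\<forall>Q. C1_in (sector T r X Q) V \<and>
          (\<forall>z \<in> sector T r X Q. ten_moment_at W V z) \<and>
          (\<exists>l. (partial_t V \<longlongrightarrow> l) (at (0, 0) within sector T r X Q)) \<and>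
          (\<exists>l. (partial_x V \<longlongrightarrow> l) (at (0, 0) within sector T r X Q)))"

end

theory Submission
  imports Defs
begin

text \<open>
  The solution has a kink, but no jump, across each wave, so its derivative along the wave is the
  same from both sides. At the origin this says that the limits \<open>a\<close>, \<open>b\<close> of the time and space
  derivatives in two adjacent sectors have the same value of \<open>a + \<sigma> b\<close>, where \<open>\<sigma>\<close> is the speed of
  the wave between them (\<open>derivative_along_wave_continuous\<close>). In the same way the initial data
  determine \<open>b\<close> in the two outer sectors (\<open>outer_left_slope\<close>, \<open>outer_right_slope\<close>). Both facts rest
  on \<open>directional_derivative_along_boundary_curve\<close>: the first-order expansion at the corner of a
  sector holds along the curves that bound the sector and not only inside it.

  By continuity of the coefficients, the differential equations hold in the limit in every sector,
  with coefficients evaluated at the single state at the origin (\<open>acoustic_balance_at_origin\<close>).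
  The equations for \<open>rho\<close>, \<open>u1\<close>, \<open>p11\<close> are closed, and what remains is linear algebra. Across a wave
  of speed \<open>\<sigma>\<close> the jumps of the slopes satisfy eigenvector relations (\<open>jump_relations\<close>), with three
  consequences.

  \<^item> The inner waves, of speeds \<open>u1\<close> and \<open>u1 \<plusminus> c / sqrt 3\<close>, leave the slopes of \<open>u1\<close> and \<open>p11\<close>
    unchanged (\<open>non_sonic_wave_preserves_u1_p11\<close>), so these slopes \<open>ux\<close>, \<open>px\<close> are common to the four
    sectors between the outermost waves.
  \<^item> The two waves of speeds \<open>u1 - c\<close> and \<open>u1 + c\<close> give \<open>p11 VL' - px = - rho c (u1 VL' - ux)\<close> and
    \<open>px - p11 VR' = rho c (ux - u1 VR')\<close>, which determine \<open>ux\<close> and \<open>px\<close>; the momentum and pressure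
    equations then give the time derivatives.
  \<^item> The slope of \<open>p11 - c\<^sup>2 rho\<close> changes at the contact only
    (\<open>entropy_slope_changes_only_at_contact\<close>). On either side of the contact it equals its initial
    value, and the transport of this quantity with speed \<open>u1\<close> (\<open>entropy_transport\<close>) expresses the
    time derivative of \<open>rho\<close> through that of \<open>p11\<close>.
\<close>

section \<open>First-order expansions up to a corner\<close>

text \<open>
  Continuous partial derivatives give a total derivative, which the chain rule along curves needs.
\<close>

lemma C1_in_has_derivative:
  assumes "open S" "C1_in S f" "z \<in> S"
  shows "(f has_derivative (\<lambda>d. fst d *\<^sub>R partial_t f z + snd d *\<^sub>R partial_x f z)) (at z)"
proof -
  obtain t x where z: "z = (t, x)" by (cases z)
  obtain A B where "open A" "open B" "z \<in> A \<times> B" "A \<times> B \<subseteq> S"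
    by (rule open_prod_elim[OF \<open>open S\<close> \<open>z \<in> S\<close>])
  then have AB: "open A" "open B" "t \<in> A" "x \<in> B" "A \<times> B \<subseteq> S"
    using z by auto
  obtain e where e: "e > 0" "ball x e \<subseteq> B" using AB open_contains_ball by blast
  let ?Y = "ball x e"
  have box: "A \<times> ?Y \<subseteq> S" using AB e by blast
  have diff: "((\<lambda>s. f (s, y)) has_vector_derivative partial_t f (t', y)) (at t')"
             "((\<lambda>y. f (t', y)) has_vector_derivative partial_x f (t', y)) (at y)"
    if "(t', y) \<in> S" for t' y
    using assms(2) that by (fastforce simp: C1_in_def partial_t_def partial_x_def dest: vector_derivative_works[THEN iffD1])+
  let ?fy = "\<lambda>t' y. blinfun_scaleR_left (partial_x f (t', y))"
  have "((\<lambda>(t', y). f (t', y)) has_derivative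
      (\<lambda>(tx, ty). (\<lambda>h. h *\<^sub>R partial_t f (t, x)) tx + ?fy t x ty)) (at (t, x) within A \<times> ?Y)"
  proof (rule has_derivative_partialsI)
    show "((\<lambda>s. f (s, x)) has_derivative (\<lambda>h. h *\<^sub>R partial_t f (t, x))) (at t within A)"
    proof -
      have "(t, x) \<in> S" using assms(3) z by simp
      from diff(1)[OF this] show ?thesis
        unfolding has_vector_derivative_def by (rule has_derivative_at_withinI)
    qed
    show "((\<lambda>y. f (t', y)) has_derivative blinfun_apply (?fy t' y)) (at y within ?Y)"
      if "t' \<in> A" "y \<in> ?Y" for t' y
    proof -
      have "(t', y) \<in> S" using that box by blast
      from diff(2)[OF this] show ?thesis
        unfolding has_vector_derivative_def blinfun_scaleR_left.rep_eq by (rule has_derivative_at_withinI)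
    qed
    have "isCont (partial_x f) (t, x)"
      using assms z by (auto simp: C1_in_def continuous_on_eq_continuous_at)
    then have "isCont (\<lambda>p. blinfun_scaleR_left (partial_x f p)) (t, x)"
      by (intro bounded_linear.isCont[OF bounded_linear_blinfun_scaleR_left])
    then show "continuous (at (t, x) within A \<times> ?Y) (\<lambda>(t', y). ?fy t' y)"
      by (simp add: case_prod_unfold continuous_at_imp_continuous_at_within)
  qed (use e in auto)
  moreover have "at (t, x) within A \<times> ?Y = at (t, x)"
    using AB e by (intro at_within_open) (auto intro: open_Times)
  ultimately show ?thesis
    unfolding z by (simp add: case_prod_unfold)
qed

text \<open>
  A curve that is \<open>C\<^sup>1\<close> up to its starting point, the origin, with initial velocity \<open>v\<close>. Only its
  germ at \<open>s = 0+\<close> matters, so every condition is a statement about \<open>at_right 0\<close>.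
\<close>

definition emanates :: "real \<times> real \<Rightarrow> (real \<Rightarrow> real \<times> real) \<Rightarrow> bool" where
  "emanates v g \<longleftrightarrow>
     (\<exists>g'. (\<forall>\<^sub>F s in at_right 0. (g has_vector_derivative g' s) (at s)) \<and>
           (g' \<longlongrightarrow> v) (at_right 0)) \<and>
     ((\<lambda>s. g s /\<^sub>R s) \<longlongrightarrow> v) (at_right 0)"

lemma emanates_tendsto_origin:
  assumes "emanates v g"
  shows "(g \<longlongrightarrow> 0) (at_right 0)"
proof -
  have "((\<lambda>s. s *\<^sub>R (g s /\<^sub>R s)) \<longlongrightarrow> 0 *\<^sub>R v) (at_right 0)"
    using assms unfolding emanates_def by (intro tendsto_intros) auto
  moreover have "\<forall>\<^sub>F s in at_right 0. s *\<^sub>R (g s /\<^sub>R s) = g s"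
    using eventually_at_right_less by eventually_elim auto
  ultimately show ?thesis by (simp add: tendsto_cong)
qed

lemma emanates_line: "emanates v (\<lambda>s. s *\<^sub>R v)"
  unfolding emanates_def
proof (intro conjI exI)
  show "\<forall>\<^sub>F s in at_right 0. ((\<lambda>s. s *\<^sub>R v) has_vector_derivative v) (at s)"
    by (auto simp: has_vector_derivative_def intro!: always_eventually derivative_eq_intros)
  show "((\<lambda>s. (s *\<^sub>R v) /\<^sub>R s) \<longlongrightarrow> v) (at_right 0)"
  proof (rule tendsto_eventually)
    show "\<forall>\<^sub>F s in at_right 0. (s *\<^sub>R v) /\<^sub>R s = v"
      using eventually_at_right_less by eventually_elim auto
  qed
qed auto

lemma emanates_add:
  assumes "emanates v g" "emanates w h"
  shows "emanates (v + w) (\<lambda>s. g s + h s)"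
proof -
  obtain g' h' where *: "\<forall>\<^sub>F s in at_right 0. (g has_vector_derivative g' s) (at s)"
      "(g' \<longlongrightarrow> v) (at_right 0)" "((\<lambda>s. g s /\<^sub>R s) \<longlongrightarrow> v) (at_right 0)"
      "\<forall>\<^sub>F s in at_right 0. (h has_vector_derivative h' s) (at s)"
      "(h' \<longlongrightarrow> w) (at_right 0)" "((\<lambda>s. h s /\<^sub>R s) \<longlongrightarrow> w) (at_right 0)"
    using assms unfolding emanates_def by blast
  show ?thesis unfolding emanates_def
  proof (intro conjI exI)
    show "\<forall>\<^sub>F s in at_right 0. ((\<lambda>s. g s + h s) has_vector_derivative g' s + h' s) (at s)"
      using *(1,4) by eventually_elim (rule has_vector_derivative_add)
    show "((\<lambda>s. g' s + h' s) \<longlongrightarrow> v + w) (at_right 0)"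
      using * by (intro tendsto_intros)
    show "((\<lambda>s. (g s + h s) /\<^sub>R s) \<longlongrightarrow> v + w) (at_right 0)"
      using tendsto_add[OF *(3,6)] by (simp add: scaleR_add_right)
  qed
qed

text \<open>
  The mean value inequality on an open interval, with the left end point replaced by a limit:
  the curves below run inside an open sector and reach its corner only in the limit.
\<close>

lemma norm_increment_le_from_limit:
  fixes \<phi> :: "real \<Rightarrow> 'a::real_normed_vector"
  assumes deriv: "\<And>s. s \<in> {0<..<\<delta>} \<Longrightarrow> (\<phi> has_vector_derivative \<phi>' s) (at s)"
    and bound: "\<And>s. s \<in> {0<..<\<delta>} \<Longrightarrow> norm (\<phi>' s) \<le> B"
    and lim: "(\<phi> \<longlongrightarrow> l) (at_right 0)"
    and s: "s \<in> {0<..<\<delta>}"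
  shows "norm (\<phi> s - l) \<le> B * s"
proof -
  have le: "norm (\<phi> s - \<phi> r) \<le> B * s" if "r \<in> {0<..<s}" for r
  proof -
    have "norm (\<phi> s - \<phi> r) \<le> B * norm (s - r)"
    proof (rule differentiable_bound[where S = "{0<..<\<delta>}" and f' = "\<lambda>s h. h *\<^sub>R \<phi>' s"])
      show "(\<phi> has_derivative (\<lambda>h. h *\<^sub>R \<phi>' u)) (at u within {0<..<\<delta>})"
        if "u \<in> {0<..<\<delta>}" for u
        using deriv[OF that] by (auto simp: has_vector_derivative_def intro: has_derivative_at_withinI)
      show "onorm (\<lambda>h. h *\<^sub>R \<phi>' u) \<le> B" if "u \<in> {0<..<\<delta>}" for u
        using bound[OF that] by (intro onorm_le) (auto simp: mult.commute[of B] intro: mult_left_mono)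
    qed (use s that in auto)
    also have "\<dots> \<le> B * s"
      using that order_trans[OF norm_ge_zero bound[OF s]] by (intro mult_left_mono) auto
    finally show ?thesis .
  qed
  have "((\<lambda>r. norm (\<phi> s - \<phi> r)) \<longlongrightarrow> norm (\<phi> s - l)) (at_right 0)"
    using lim by (intro tendsto_intros)
  moreover have "\<forall>\<^sub>F r in at_right 0. norm (\<phi> s - \<phi> r) \<le> B * s"
    using s le by (auto simp: eventually_at_right_field)
  ultimately show ?thesis
    by (intro tendsto_upperbound) auto
qed

text \<open>
  A function that is \<open>C\<^sup>1\<close> in an open set with corner \<open>(0, 0)\<close> and whose partial derivatives
  have limits there is differentiable at the corner along a curve that merely bounds the set.
  After subtraction of the linear function with the limiting derivatives, the gradient is small
  near the corner. The curves \<open>(1 - \<theta>) g + \<theta> h\<close> lie inside the set and have uniformly bounded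
  speeds, so the remainder is at most \<open>e * s\<close> along each of them, with \<open>e\<close> independent of \<open>\<theta>\<close>.
  Letting \<open>\<theta>\<close> tend to 0 transfers the bound to \<open>g\<close>, since \<open>f\<close> is continuous up to that curve.
\<close>

lemma directional_derivative_along_boundary_curve:
  fixes f :: "real \<times> real \<Rightarrow> 'a::real_normed_vector"
  assumes S: "open S" "(0, 0) \<notin> S" "C1_in S f"
    and a: "(partial_t f \<longlongrightarrow> a) (at (0, 0) within S)"
    and b: "(partial_x f \<longlongrightarrow> b) (at (0, 0) within S)"
    and g: "emanates v g" and h: "emanates w h"
    and seg: "\<forall>\<^sub>F s in at_right 0. \<forall>\<theta>\<in>{0<..<1}. (1 - \<theta>) *\<^sub>R g s + \<theta> *\<^sub>R h s \<in> S"
    and cont: "continuous_on D f" and D: "S \<subseteq> D" "(0, 0) \<in> D" "\<forall>\<^sub>F s in at_right 0. g s \<in> D"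
  shows "((\<lambda>s. (f (g s) - f (0, 0)) /\<^sub>R s) \<longlongrightarrow> fst v *\<^sub>R a + snd v *\<^sub>R b) (at_right 0)"
proof -
  define F where "F = (\<lambda>z. f z - fst z *\<^sub>R a - snd z *\<^sub>R b)"
  define \<gamma> where "\<gamma> = (\<lambda>\<theta> s. (1 - \<theta>) *\<^sub>R g s + \<theta> *\<^sub>R h s)"
  obtain g' h' where
      g': "\<forall>\<^sub>F s in at_right 0. (g has_vector_derivative g' s) (at s)" "(g' \<longlongrightarrow> v) (at_right 0)"
    and h': "\<forall>\<^sub>F s in at_right 0. (h has_vector_derivative h' s) (at s)" "(h' \<longlongrightarrow> w) (at_right 0)"
    using g h unfolding emanates_def by blast
  define C where "C = norm v + norm w + 1"
  have C: "C > 0" unfolding C_def by (smt (verit) norm_ge_zero)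
  have contF: "continuous_on D F"
    unfolding F_def by (intro continuous_intros cont)
  have small: "\<forall>\<^sub>F s in at_right 0. norm (F (g s) - F (0, 0)) \<le> e * s" if "e > 0" for e
  proof -
    \<comment> \<open>Two components of the velocity, each of size at most \<open>C\<close>, multiply the gradient.\<close>
    define \<epsilon> where "\<epsilon> = e / (2 * C)"
    have "\<epsilon> > 0" using that C by (simp add: \<epsilon>_def)
    obtain d where d: "d > 0" and near:
      "\<And>z. z \<in> S \<Longrightarrow> norm z < d \<Longrightarrow> norm (partial_t f z - a) < \<epsilon> \<and> norm (partial_x f z - b) < \<epsilon>"
    proof -
      have "\<forall>\<^sub>F z in at (0, 0) within S. norm (partial_t f z - a) < \<epsilon> \<and> norm (partial_x f z - b) < \<epsilon>"
        using tendstoD[OF a \<open>\<epsilon> > 0\<close>] tendstoD[OF b \<open>\<epsilon> > 0\<close>]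
        by eventually_elim (auto simp: dist_norm)
      then show ?thesis
        using that S(2) unfolding eventually_at by (metis dist_0_norm dist_commute zero_prod_def)
    qed
    have "\<forall>\<^sub>F s in at_right 0. norm (g' s) < C"
      using g'(2) by (intro order_tendstoD[OF tendsto_norm]) (auto simp: C_def add_nonneg_pos)
    moreover have "\<forall>\<^sub>F s in at_right 0. norm (h' s) < C"
      using h'(2) by (intro order_tendstoD[OF tendsto_norm]) (auto simp: C_def add_pos_nonneg add_nonneg_pos)
    moreover have "\<forall>\<^sub>F s in at_right 0. norm (g s) < d" "\<forall>\<^sub>F s in at_right 0. norm (h s) < d"
      using d by (auto intro!: order_tendstoD(2)[OF tendsto_norm_zero] emanates_tendsto_origin[OF g]
          emanates_tendsto_origin[OF h])
    ultimately have "\<forall>\<^sub>F s in at_right 0.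
        (g has_vector_derivative g' s) (at s) \<and> (h has_vector_derivative h' s) (at s) \<and>
        norm (g' s) < C \<and> norm (h' s) < C \<and> norm (g s) < d \<and> norm (h s) < d \<and>
        (\<forall>\<theta>\<in>{0<..<1}. \<gamma> \<theta> s \<in> S) \<and> g s \<in> D"
      using g'(1) h'(1) seg D(3) unfolding \<gamma>_def by eventually_elim auto
    then obtain \<delta> where "\<delta> > 0" and \<delta>: "\<And>s. s \<in> {0<..<\<delta>} \<Longrightarrow>
        (g has_vector_derivative g' s) (at s) \<and> (h has_vector_derivative h' s) (at s) \<and>
        norm (g' s) < C \<and> norm (h' s) < C \<and> norm (g s) < d \<and> norm (h s) < d \<and>
        (\<forall>\<theta>\<in>{0<..<1}. \<gamma> \<theta> s \<in> S) \<and> g s \<in> D"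
      by (auto simp: eventually_at_right_field)
    have convex_bound: "norm ((1 - \<theta>) *\<^sub>R p + \<theta> *\<^sub>R q) \<le> K"
      if "\<theta> \<in> {0<..<1}" "norm p \<le> K" "norm q \<le> K" for \<theta> K and p q :: "real \<times> real"
    proof -
      have "(1 - \<theta>) *\<^sub>R p + \<theta> *\<^sub>R q \<in> cball 0 K"
        using that by (intro convexD) auto
      then show ?thesis by simp
    qed
    have interior: "norm (F (\<gamma> \<theta> s) - F (0, 0)) \<le> e * s"
      if s: "s \<in> {0<..<\<delta>}" and \<theta>: "\<theta> \<in> {0<..<1}" for s \<theta>
    proof (rule norm_increment_le_from_limit[where \<phi> = "\<lambda>s. F (\<gamma> \<theta> s)" and \<delta> = \<delta>])
      fix r assume r: "r \<in> {0<..<\<delta>}"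
      let ?z = "\<gamma> \<theta> r" and ?z' = "(1 - \<theta>) *\<^sub>R g' r + \<theta> *\<^sub>R h' r"
      let ?F' = "fst ?z' *\<^sub>R (partial_t f ?z - a) + snd ?z' *\<^sub>R (partial_x f ?z - b)"
      have z: "?z \<in> S" using \<delta>[OF r] \<theta> by auto
      have dF: "(F has_derivative (\<lambda>p. fst p *\<^sub>R (partial_t f ?z - a) + snd p *\<^sub>R (partial_x f ?z - b)))
          (at ?z)"
        unfolding F_def
        by (auto intro!: derivative_eq_intros C1_in_has_derivative[OF S(1,3) z] simp: algebra_simps)
      have "(\<gamma> \<theta> has_vector_derivative ?z') (at r)"
        unfolding \<gamma>_def using \<delta>[OF r] 
        by (intro has_vector_derivative_add bounded_linear.has_vector_derivative[OF bounded_linear_scaleR_right])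
          auto
      from vector_derivative_diff_chain_within[OF this has_derivative_at_withinI[OF dF]]
      show "((\<lambda>s. F (\<gamma> \<theta> s)) has_vector_derivative ?F') (at r)"
        by (simp add: o_def)
      have *: "norm ?z' \<le> C" "norm ?z < d"
      proof -
        show "norm ?z' \<le> C" using \<delta>[OF r] \<theta> by (intro convex_bound) auto
        have "norm ?z \<le> max (norm (g r)) (norm (h r))"
          unfolding \<gamma>_def using \<theta> by (intro convex_bound) auto
        then show "norm ?z < d" using \<delta>[OF r] by auto
      qed
      have comp_le: "\<bar>fst ?z'\<bar> \<le> C" "\<bar>snd ?z'\<bar> \<le> C"
        using norm_fst_le[of "fst ?z'" "snd ?z'"] norm_snd_le[of "snd ?z'" "fst ?z'"] *(1)
        unfolding prod.collapse real_norm_def by linarith+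
      have "norm ?F' \<le> \<bar>fst ?z'\<bar> * norm (partial_t f ?z - a) + \<bar>snd ?z'\<bar> * norm (partial_x f ?z - b)"
        by (metis norm_scaleR norm_triangle_ineq)
      also have "\<dots> \<le> C * \<epsilon> + C * \<epsilon>"
        using near[OF z *(2)] comp_le C by (intro add_mono mult_mono) auto
      also have "\<dots> = e" using C by (simp add: \<epsilon>_def)
      finally show "norm ?F' \<le> e" .
    next
      show "((\<lambda>s. F (\<gamma> \<theta> s)) \<longlongrightarrow> F (0, 0)) (at_right 0)"
      proof (rule continuous_on_tendsto_compose[OF contF])
        have "(\<gamma> \<theta> \<longlongrightarrow> (1 - \<theta>) *\<^sub>R 0 + \<theta> *\<^sub>R 0) (at_right 0)"
          unfolding \<gamma>_def
          by (intro tendsto_intros emanates_tendsto_origin[OF g] emanates_tendsto_origin[OF h])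
        then show "(\<gamma> \<theta> \<longlongrightarrow> (0, 0)) (at_right 0)" by (simp add: zero_prod_def)
        show "\<forall>\<^sub>F s in at_right 0. \<gamma> \<theta> s \<in> D"
          using seg by eventually_elim (use \<theta> D in \<open>auto simp: \<gamma>_def\<close>)
      qed (use D in auto)
    qed (use s in auto)
    have "norm (F (g s) - F (0, 0)) \<le> e * s" if s: "s \<in> {0<..<\<delta>}" for s
    proof (rule tendsto_upperbound)
      have "((\<lambda>\<theta>. \<gamma> \<theta> s) \<longlongrightarrow> (1 - 0) *\<^sub>R g s + 0 *\<^sub>R h s) (at_right 0)"
        unfolding \<gamma>_def by (intro tendsto_intros)
      then have "((\<lambda>\<theta>. F (\<gamma> \<theta> s)) \<longlongrightarrow> F (g s)) (at_right 0)"
        using \<delta>[OF s] D(1)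
        by (intro continuous_on_tendsto_compose[OF contF]) (auto simp: eventually_at_right_field intro!: exI[of _ 1])
      then show "((\<lambda>\<theta>. norm (F (\<gamma> \<theta> s) - F (0, 0))) \<longlongrightarrow> norm (F (g s) - F (0, 0))) (at_right 0)"
        by (intro tendsto_intros)
      show "\<forall>\<^sub>F \<theta> in at_right 0. norm (F (\<gamma> \<theta> s) - F (0, 0)) \<le> e * s"
        using interior[OF s] by (auto simp: eventually_at_right_field intro!: exI[of _ 1])
    qed auto
    then show ?thesis
      using \<open>\<delta> > 0\<close> by (auto simp: eventually_at_right_field)
  qed
  have "((\<lambda>s. (F (g s) - F (0, 0)) /\<^sub>R s) \<longlongrightarrow> 0) (at_right 0)"
  proof (rule tendstoI)
    fix e :: real assume "e > 0"
    show "\<forall>\<^sub>F s in at_right 0. dist ((F (g s) - F (0, 0)) /\<^sub>R s) 0 < e"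
      using small[OF half_gt_zero[OF \<open>e > 0\<close>]] eventually_at_right_less[of 0]
    proof eventually_elim
      case (elim s)
      then have *: "norm (F (g s) - F (0, 0)) < e * s"
        using \<open>e > 0\<close> mult_pos_pos[of e s] by linarith
      have "dist ((F (g s) - F (0, 0)) /\<^sub>R s) 0 = norm (F (g s) - F (0, 0)) / s"
        using elim unfolding dist_norm diff_zero norm_scaleR by (simp only: abs_inverse abs_of_pos divide_inverse mult.commute)
      also have "\<dots> < e" using * elim by (simp add: pos_divide_less_eq)
      finally show ?case .
    qed
  qed
  moreover have "((\<lambda>s. fst (g s /\<^sub>R s) *\<^sub>R a + snd (g s /\<^sub>R s) *\<^sub>R b) \<longlongrightarrow>
      fst v *\<^sub>R a + snd v *\<^sub>R b) (at_right 0)"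
    using g unfolding emanates_def
    by (intro tendsto_add tendsto_scaleR tendsto_fst tendsto_snd tendsto_const) auto
  ultimately have "((\<lambda>s. (F (g s) - F (0, 0)) /\<^sub>R s + (fst (g s /\<^sub>R s) *\<^sub>R a + snd (g s /\<^sub>R s) *\<^sub>R b))
      \<longlongrightarrow> 0 + (fst v *\<^sub>R a + snd v *\<^sub>R b)) (at_right 0)"
    by (rule tendsto_add)
  moreover have "(F (g s) - F (0, 0)) /\<^sub>R s + (fst (g s /\<^sub>R s) *\<^sub>R a + snd (g s /\<^sub>R s) *\<^sub>R b) =
      (f (g s) - f (0, 0)) /\<^sub>R s" for s
    by (simp add: F_def scaleR_diff_right scaleR_add_right)
  ultimately show ?thesis by simp
qed

lemma at_corner_within_nontrivial:
  fixes S :: "(real \<times> real) set"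
  assumes "(0, 0) \<notin> S" "emanates v g" "emanates w h"
    and seg: "\<forall>\<^sub>F s in at_right 0. \<forall>\<theta>\<in>{0<..<1}. (1 - \<theta>) *\<^sub>R g s + \<theta> *\<^sub>R h s \<in> S"
  shows "at (0, 0) within S \<noteq> bot"
proof -
  let ?m = "\<lambda>s. (1 - 1 / 2) *\<^sub>R g s + (1 / 2) *\<^sub>R h s"
  have "(?m \<longlongrightarrow> (1 - 1 / 2) *\<^sub>R 0 + (1 / 2) *\<^sub>R 0) (at_right 0)"
    by (intro tendsto_intros emanates_tendsto_origin[OF assms(2)] emanates_tendsto_origin[OF assms(3)])
  moreover have ev: "\<forall>\<^sub>F s in at_right 0. ?m s \<in> S"
    using seg by eventually_elim (rule bspec, assumption, simp)
  moreover have "\<forall>\<^sub>F s in at_right 0. ?m s \<in> S \<and> ?m s \<noteq> (0, 0)"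
    using ev by eventually_elim (use assms(1) in metis)
  ultimately have "filterlim ?m (at (0, 0) within S) (at_right 0)"
    unfolding filterlim_at by (simp add: zero_prod_def)
  then have "at (0, 0) within S = bot \<Longrightarrow> filtermap ?m (at_right 0) = bot"
    by (simp add: filterlim_def le_bot)
  then show ?thesis
    by (auto simp: filtermap_bot_iff)
qed

section \<open>The sectors and the curves that bound them\<close>

fun left_sector :: "wave \<Rightarrow> region" where
  "left_sector Wave1 = Outer_L"
| "left_sector Wave2 = Star_L"
| "left_sector Contact = StarStar_L"
| "left_sector Wave5 = StarStar_R"
| "left_sector Wave6 = Star_R"

fun right_sector :: "wave \<Rightarrow> region" where
  "right_sector Wave1 = Star_L"
| "right_sector Wave2 = StarStar_L"
| "right_sector Contact = StarStar_R"
| "right_sector Wave5 = Star_R"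
| "right_sector Wave6 = Outer_R"

lemma origin_notin_sector: "(0, 0) \<notin> sector T r X Q"
  by (cases Q) auto

lemma wave_curve_continuous:
  assumes "wave_curves V T r X"
  shows "continuous_on {0..<T} (X w)"
  using assms unfolding wave_curves_def
  by (intro continuous_on_eq_continuous_within[THEN iffD2] ballI) (blast intro: DERIV_continuous)

lemma open_sector:
  assumes "wave_curves V T r X"
  shows "open (sector T r X Q)"
proof -
  have contX: "continuous_on {0<..<T} (X w)" for w
    using wave_curve_continuous[OF assms] by (rule continuous_on_subset) auto
  have *: "open {(t, x). 0 < t \<and> t < T \<and> Y t < x}" "open {(t, x). 0 < t \<and> t < T \<and> x < Y t}"
    if "continuous_on {0<..<T} Y" for Y :: "real \<Rightarrow> real"
  proof -
    have c: "continuous_on ({0<..<T} \<times> UNIV) (\<lambda>z. snd z - Y (fst z))"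
      by (intro continuous_intros continuous_on_compose2[OF that]) auto
    have "open (({0<..<T} \<times> UNIV) \<inter> (\<lambda>z. snd z - Y (fst z)) -` {0<..})"
         "open (({0<..<T} \<times> UNIV) \<inter> (\<lambda>z. snd z - Y (fst z)) -` {..<0})"
      by (intro continuous_open_preimage[OF c] open_Times; simp)+
    moreover have "({0<..<T} \<times> UNIV) \<inter> (\<lambda>z. snd z - Y (fst z)) -` {0<..} =
          {(t, x). 0 < t \<and> t < T \<and> Y t < x}"
        "({0<..<T} \<times> UNIV) \<inter> (\<lambda>z. snd z - Y (fst z)) -` {..<0} =
          {(t, x). 0 < t \<and> t < T \<and> x < Y t}"
      by auto
    ultimately show "open {(t, x). 0 < t \<and> t < T \<and> Y t < x}"
        "open {(t, x). 0 < t \<and> t < T \<and> x < Y t}"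
      by auto
  qed
  have strip: "open ({(t, x). 0 < t \<and> t < T \<and> Y t < x} \<inter> {(t, x). 0 < t \<and> t < T \<and> x < Z t})"
    if "continuous_on {0<..<T} Y" "continuous_on {0<..<T} Z" for Y Z :: "real \<Rightarrow> real"
    using *(1)[OF that(1)] *(2)[OF that(2)] by (rule open_Int)
  have "sector T r X Q =
      {(t, x). 0 < t \<and> t < T \<and> (case Q of Outer_L \<Rightarrow> \<lambda>_. - r | Star_L \<Rightarrow> X Wave1
          | StarStar_L \<Rightarrow> X Wave2 | StarStar_R \<Rightarrow> X Contact | Star_R \<Rightarrow> X Wave5
          | Outer_R \<Rightarrow> X Wave6) t < x} \<inter>
      {(t, x). 0 < t \<and> t < T \<and> x < (case Q of Outer_L \<Rightarrow> X Wave1 | Star_L \<Rightarrow> X Wave2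
          | StarStar_L \<Rightarrow> X Contact | StarStar_R \<Rightarrow> X Wave5 | Star_R \<Rightarrow> X Wave6
          | Outer_R \<Rightarrow> \<lambda>_. r) t}"
    by (cases Q) auto
  also have "open \<dots>"
    by (rule strip; cases Q) (auto intro: contX continuous_intros)
  finally show ?thesis .
qed

lemma sector_subset_strip:
  assumes "wave_curves V T r X"
  shows "sector T r X Q \<subseteq> {0..<T} \<times> {-r<..<r}"
proof (rule subrelI)
  fix t x assume z: "(t, x) \<in> sector T r X Q"
  then have "0 < t" "t < T" by (cases Q; auto)+
  then have "- r < X w t \<and> X w t < r" for w
    using assms unfolding wave_curves_def by (smt (verit) atLeastLessThan_iff)
  note this[of Wave1] this[of Wave2] this[of Contact] this[of Wave5] this[of Wave6]
  with z show "(t, x) \<in> {0..<T} \<times> {-r<..<r}"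
    by (cases Q) auto
qed

lemma char_speed_tendsto:
  assumes "(v \<longlongrightarrow> v0) F" "rho v0 \<noteq> 0"
  shows "((\<lambda>s. char_speed w (v s)) \<longlongrightarrow> char_speed w v0) F"
proof -
  have "((\<lambda>s. sound_speed (v s)) \<longlongrightarrow> sound_speed v0) F"
    using assms unfolding sound_speed_def rho_def p11_def by (intro tendsto_intros)
  moreover have "((\<lambda>s. u1 (v s)) \<longlongrightarrow> u1 v0) F"
    using assms unfolding u1_def by (intro tendsto_intros)
  ultimately show ?thesis
    by (cases w) (auto intro!: tendsto_add tendsto_diff tendsto_divide)
qed

lemma convex_combination_strictly_between:
  fixes p q \<theta> :: real
  assumes "p < q" "\<theta> \<in> {0<..<1}"
  shows "p < (1 - \<theta>) * p + \<theta> * q" "(1 - \<theta>) * p + \<theta> * q < q"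
    "p < (1 - \<theta>) * q + \<theta> * p" "(1 - \<theta>) * q + \<theta> * p < q"
proof -
  have "0 < \<theta> * (q - p)" "0 < (1 - \<theta>) * (q - p)" using assms by auto
  then show "p < (1 - \<theta>) * p + \<theta> * q" "(1 - \<theta>) * p + \<theta> * q < q"
    "p < (1 - \<theta>) * q + \<theta> * p" "(1 - \<theta>) * q + \<theta> * p < q"
    by (auto simp: algebra_simps)
qed

context
  fixes W :: "real \<Rightarrow> real" and V :: "real \<times> real \<Rightarrow> state"
    and X :: "wave \<Rightarrow> real \<Rightarrow> real" and T r :: real
  assumes sol: "acoustic_wave_solution W V T r X"
begin

lemma T_r_pos: "0 < T" "0 < r"
  and V_continuous: "continuous_on ({0..<T} \<times> {-r<..<r}) V"
  and curves: "wave_curves V T r X"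
  and V_C1: "C1_in (sector T r X Q) V"
  using sol by (auto simp: acoustic_wave_solution_def)

lemma V_admissible: "z \<in> {0..<T} \<times> {-r<..<r} \<Longrightarrow> admissible (V z)"
  using sol unfolding acoustic_wave_solution_def by blast

lemma origin_in_strip: "(0, 0) \<in> {0..<T} \<times> {-r<..<r}"
  using T_r_pos by auto

lemma eventually_in_time_interval: "\<forall>\<^sub>F s in at_right 0. 0 < s \<and> s < T"
  using T_r_pos by (auto simp: eventually_at_right_field)

lemma wave_curve_in_strip: "\<forall>\<^sub>F s in at_right 0. (s, X w s) \<in> {0..<T} \<times> {-r<..<r}"
  using eventually_in_time_interval
proof eventually_elim
  case (elim s)
  then have "\<bar>X w s\<bar> < r" using curves by (auto simp: wave_curves_def)
  then show ?case using elim by auto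
qed

text \<open>
  The characteristic equation determines the initial velocity, because \<open>V\<close> is continuous at the
  origin; the same continuity makes the velocity continuous up to \<open>t = 0\<close>.
\<close>

lemma wave_curve_emanates: "emanates (1, char_speed w (V (0, 0))) (\<lambda>s. (s, X w s))"
proof -
  have deriv: "(X w has_real_derivative char_speed w (V (t, X w t))) (at t within {0..<T})"
    if "t \<in> {0..<T}" for t
    using curves that by (auto simp: wave_curves_def)
  have X0: "X w 0 = 0" using curves by (simp add: wave_curves_def)
  have filt: "at 0 within {0..<T} = at_right 0"
    using T_r_pos by (intro at_within_nhd[of _ "{..<T}"]) auto
  have quot: "((\<lambda>s. X w s / s) \<longlongrightarrow> char_speed w (V (0, 0))) (at_right 0)"
    using deriv[of 0] T_r_pos X0 filt by (simp add: has_field_derivative_iff)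
  have lim: "(X w \<longlongrightarrow> 0) (at_right 0)"
    using DERIV_continuous[OF deriv[of 0]] T_r_pos X0 filt by (simp add: continuous_within)
  have "((\<lambda>s. V (s, X w s)) \<longlongrightarrow> V (0, 0)) (at_right 0)"
    by (intro continuous_on_tendsto_compose[OF V_continuous] tendsto_Pair tendsto_ident_at lim
        origin_in_strip wave_curve_in_strip)
  then have speed: "((\<lambda>s. char_speed w (V (s, X w s))) \<longlongrightarrow> char_speed w (V (0, 0))) (at_right 0)"
    using V_admissible[OF origin_in_strip] by (intro char_speed_tendsto) (auto simp: admissible_def)
  show ?thesis unfolding emanates_def
  proof (intro conjI exI)
    show "\<forall>\<^sub>F s in at_right 0. ((\<lambda>s. (s, X w s)) has_vector_derivative
        (1, char_speed w (V (s, X w s)))) (at s)"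
      using eventually_in_time_interval
    proof eventually_elim
      case (elim s)
      have "at s within {0..<T} = at s"
        using elim by (intro at_within_interior) (simp add: interior_atLeastLessThan)
      then have "(X w has_real_derivative char_speed w (V (s, X w s))) (at s)"
        using deriv[of s] elim by simp
      then show ?case
        by (intro has_vector_derivative_Pair)
          (auto simp: has_real_derivative_iff_has_vector_derivative)
    qed
    show "((\<lambda>s. (1, char_speed w (V (s, X w s)))) \<longlongrightarrow> (1, char_speed w (V (0, 0)))) (at_right 0)"
      by (intro tendsto_Pair tendsto_const speed)
    have "((\<lambda>s. (1, X w s / s)) \<longlongrightarrow> (1, char_speed w (V (0, 0)))) (at_right 0)"
      by (intro tendsto_Pair tendsto_const quot)
    moreover have "\<forall>\<^sub>F s in at_right 0. (1, X w s / s) = (s, X w s) /\<^sub>R s"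
      using eventually_in_time_interval
      by eventually_elim (simp add: divide_inverse mult.commute)
    ultimately show "((\<lambda>s. (s, X w s) /\<^sub>R s) \<longlongrightarrow> (1, char_speed w (V (0, 0)))) (at_right 0)"
      by (rule Lim_transform_eventually)
  qed
qed

lemma wave_curve_tendsto_zero: "(X w \<longlongrightarrow> 0) (at_right 0)"
  using tendsto_snd[OF emanates_tendsto_origin[OF wave_curve_emanates[of w]]] by simp

text \<open>
  The partner \<open>h\<close> of the curve is the wave next to it, as long as there is one. To the left of the
  1-wave the only other boundary is \<open>x = - r\<close>, which stays away from the origin; there
  \<open>x = X Wave1 t - t\<close> serves instead.
\<close>

lemma wave_curve_borders_left_sector:
  obtains v h where "emanates v h"
    "\<forall>\<^sub>F s in at_right 0. \<forall>\<theta>\<in>{0<..<1}. (1 - \<theta>) *\<^sub>R (s, X w s) + \<theta> *\<^sub>R h s \<in> sector T r X (left_sector w)"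
proof (cases "w = Wave1")
  case True
  have "((\<lambda>s. X Wave1 s - s) \<longlongrightarrow> 0 - 0) (at_right 0)"
    by (intro tendsto_intros wave_curve_tendsto_zero)
  then have "\<forall>\<^sub>F s in at_right 0. - r < X Wave1 s - s"
    using T_r_pos by (intro order_tendstoD) auto
  then have "\<forall>\<^sub>F s in at_right 0. \<forall>\<theta>\<in>{0<..<1}.
      (1 - \<theta>) *\<^sub>R (s, X w s) + \<theta> *\<^sub>R ((s, X w s) + s *\<^sub>R (0, - 1)) \<in> sector T r X (left_sector w)"
    using eventually_in_time_interval
  proof eventually_elim
    case (elim s)
    have "(1 - \<theta>) *\<^sub>R (s, X w s) + \<theta> *\<^sub>R ((s, X w s) + s *\<^sub>R (0, - 1)) = (s, X w s - \<theta> * s)" for \<theta>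
      by (simp add: algebra_simps)
    moreover have "0 < \<theta> * s \<and> \<theta> * s < s" if "\<theta> \<in> {0<..<1}" for \<theta>
      using that elim by auto
    ultimately show ?case
      using True elim by fastforce
  qed
  then show ?thesis
    by (rule that[OF emanates_add[OF wave_curve_emanates emanates_line]])
next
  case False
  define w' where "w' = (case w of Wave2 \<Rightarrow> Wave1 | Contact \<Rightarrow> Wave2 | Wave5 \<Rightarrow> Contact | _ \<Rightarrow> Wave5)"
  have "\<forall>\<^sub>F s in at_right 0. \<forall>\<theta>\<in>{0<..<1}.
      (1 - \<theta>) *\<^sub>R (s, X w s) + \<theta> *\<^sub>R (s, X w' s) \<in> sector T r X (left_sector w)"
    using eventually_in_time_interval
  proof eventually_elim
    case (elim s)
    have "(1 - \<theta>) * s + \<theta> * s = s" for \<theta> by (simp add: algebra_simps)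
    moreover have "X w' s < X w s"
      using curves elim False by (cases w) (auto simp: wave_curves_def w'_def)
    note convex_combination_strictly_between[OF this]
    ultimately show ?case
      using elim False by (cases w) (auto simp: w'_def)
  qed
  then show ?thesis by (rule that[OF wave_curve_emanates])
qed

lemma wave_curve_borders_right_sector:
  obtains v h where "emanates v h"
    "\<forall>\<^sub>F s in at_right 0. \<forall>\<theta>\<in>{0<..<1}. (1 - \<theta>) *\<^sub>R (s, X w s) + \<theta> *\<^sub>R h s \<in> sector T r X (right_sector w)"
proof (cases "w = Wave6")
  case True
  have "((\<lambda>s. X Wave6 s + s) \<longlongrightarrow> 0 + 0) (at_right 0)"
    by (intro tendsto_intros wave_curve_tendsto_zero)
  then have "\<forall>\<^sub>F s in at_right 0. X Wave6 s + s < r"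
    using T_r_pos by (intro order_tendstoD) auto
  then have "\<forall>\<^sub>F s in at_right 0. \<forall>\<theta>\<in>{0<..<1}.
      (1 - \<theta>) *\<^sub>R (s, X w s) + \<theta> *\<^sub>R ((s, X w s) + s *\<^sub>R (0, 1)) \<in> sector T r X (right_sector w)"
    using eventually_in_time_interval
  proof eventually_elim
    case (elim s)
    have "(1 - \<theta>) *\<^sub>R (s, X w s) + \<theta> *\<^sub>R ((s, X w s) + s *\<^sub>R (0, 1)) = (s, X w s + \<theta> * s)" for \<theta>
      by (simp add: algebra_simps)
    moreover have "0 < \<theta> * s \<and> \<theta> * s < s" if "\<theta> \<in> {0<..<1}" for \<theta>
      using that elim by auto
    ultimately show ?case
      using True elim by fastforce
  qed
  then show ?thesis
    by (rule that[OF emanates_add[OF wave_curve_emanates emanates_line]])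
next
  case False
  define w' where "w' = (case w of Wave1 \<Rightarrow> Wave2 | Wave2 \<Rightarrow> Contact | Contact \<Rightarrow> Wave5 | _ \<Rightarrow> Wave6)"
  have "\<forall>\<^sub>F s in at_right 0. \<forall>\<theta>\<in>{0<..<1}.
      (1 - \<theta>) *\<^sub>R (s, X w s) + \<theta> *\<^sub>R (s, X w' s) \<in> sector T r X (right_sector w)"
    using eventually_in_time_interval
  proof eventually_elim
    case (elim s)
    have "(1 - \<theta>) * s + \<theta> * s = s" for \<theta> by (simp add: algebra_simps)
    moreover have "X w s < X w' s"
      using curves elim False by (cases w) (auto simp: wave_curves_def w'_def)
    note convex_combination_strictly_between[OF this]
    ultimately show ?case
      using elim False by (cases w) (auto simp: w'_def)
  qed
  then show ?thesis by (rule that[OF wave_curve_emanates])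
qed

text \<open>
  Seen from the \<open>x\<close>-axis, a wave of finite speed leaves room: the segment from \<open>(0, \<plusminus> s)\<close> to
  \<open>(\<kappa> * s, \<plusminus> s)\<close> does not meet it if \<open>\<kappa>\<close> is small. This connects the initial data to the
  outer sectors.
\<close>

lemma wave_curve_small_slope:
  obtains \<kappa> where "\<kappa> > 0"
    "\<forall>\<^sub>F s in at_right 0. \<forall>\<theta>\<in>{0<..<1}. \<theta> * \<kappa> * s < T \<and> \<bar>X w (\<theta> * \<kappa> * s)\<bar> < s"
proof -
  \<comment> \<open>Near the origin the curve satisfies \<open>\<bar>x\<bar> < \<Lambda> * t\<close>, so \<open>\<kappa> = 1 / \<Lambda>\<close> is small enough.\<close>
  define \<Lambda> where "\<Lambda> = \<bar>char_speed w (V (0, 0))\<bar> + 1"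
  have "\<Lambda> > 0" by (simp add: \<Lambda>_def add_nonneg_pos)
  have "((\<lambda>s. snd ((s, X w s) /\<^sub>R s)) \<longlongrightarrow> char_speed w (V (0, 0))) (at_right 0)"
    using tendsto_snd[of "\<lambda>s. (s, X w s) /\<^sub>R s"] wave_curve_emanates[of w]
    by (fastforce simp: emanates_def)
  then have "\<forall>\<^sub>F s in at_right 0. \<bar>snd ((s, X w s) /\<^sub>R s)\<bar> < \<Lambda>"
    by (intro order_tendstoD(2)[OF tendsto_rabs]) (auto simp: \<Lambda>_def)
  then have "\<forall>\<^sub>F s in at_right 0. 0 < s \<and> s < T \<and> \<bar>X w s\<bar> < \<Lambda> * s"
    using eventually_in_time_interval
  proof eventually_elim
    case (elim s)
    then have "\<bar>X w s / s\<bar> < \<Lambda>" by (simp add: divide_inverse mult.commute)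
    with elim show ?case by (simp add: abs_divide pos_divide_less_eq)
  qed
  then obtain \<delta> where \<delta>: "\<delta> > 0" "\<And>s. 0 < s \<Longrightarrow> s < \<delta> \<Longrightarrow> s < T \<and> \<bar>X w s\<bar> < \<Lambda> * s"
    by (auto simp: eventually_at_right_field)
  show ?thesis
  proof (rule that[of "1 / \<Lambda>"])
    have "\<theta> * (1 / \<Lambda>) * s < T \<and> \<bar>X w (\<theta> * (1 / \<Lambda>) * s)\<bar> < s"
      if s: "0 < s" "s < \<delta> * \<Lambda>" and \<theta>: "\<theta> \<in> {0<..<1}" for s \<theta>
    proof -
      have lt: "\<theta> * s < s" "0 < \<theta> * s" using s \<theta> by auto
      then have "0 < \<theta> * (1 / \<Lambda>) * s" "\<theta> * (1 / \<Lambda>) * s < \<delta>"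
        using s(2) \<open>\<Lambda> > 0\<close> less_trans[OF lt(1) s(2)] by (auto simp: field_simps)
      from \<delta>(2)[OF this] show ?thesis
        using lt \<open>\<Lambda> > 0\<close> by auto
    qed
    then show "\<forall>\<^sub>F s in at_right 0. \<forall>\<theta>\<in>{0<..<1}. \<theta> * (1 / \<Lambda>) * s < T \<and> \<bar>X w (\<theta> * (1 / \<Lambda>) * s)\<bar> < s"
      using \<delta>(1) \<open>\<Lambda> > 0\<close> by (auto simp: eventually_at_right_field intro!: exI[of _ "\<delta> * \<Lambda>"])
  qed (use \<open>\<Lambda> > 0\<close> in auto)
qed

lemma initial_line_borders_outer_left:
  obtains v h where "emanates v h"
    "\<forall>\<^sub>F s in at_right 0. \<forall>\<theta>\<in>{0<..<1}. (1 - \<theta>) *\<^sub>R s *\<^sub>R (0, - 1) + \<theta> *\<^sub>R h s \<in> sector T r X Outer_L"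
proof -
  obtain \<kappa> where \<kappa>: "\<kappa> > 0"
    "\<forall>\<^sub>F s in at_right 0. \<forall>\<theta>\<in>{0<..<1}. \<theta> * \<kappa> * s < T \<and> \<bar>X Wave1 (\<theta> * \<kappa> * s)\<bar> < s"
    by (rule wave_curve_small_slope)
  have "\<forall>\<^sub>F s in at_right 0. 0 < s \<and> s < r"
    using T_r_pos by (auto simp: eventually_at_right_field)
  with \<kappa>(2) have "\<forall>\<^sub>F s in at_right 0. \<forall>\<theta>\<in>{0<..<1}.
      (1 - \<theta>) *\<^sub>R s *\<^sub>R (0, - 1) + \<theta> *\<^sub>R s *\<^sub>R (\<kappa>, - 1) \<in> sector T r X Outer_L"
  proof eventually_elim
    case (elim s)
    show ?case
    proof
      fix \<theta> :: real assume \<theta>: "\<theta> \<in> {0<..<1}"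
      have eq: "(1 - \<theta>) *\<^sub>R s *\<^sub>R (0, - 1) + \<theta> *\<^sub>R s *\<^sub>R (\<kappa>, - 1) = (\<theta> * \<kappa> * s, - s)"
        by (simp add: algebra_simps)
      have "0 < \<theta> * \<kappa> * s" using \<theta> \<kappa>(1) elim(2) by simp
      with elim \<theta> show "(1 - \<theta>) *\<^sub>R s *\<^sub>R (0, - 1) + \<theta> *\<^sub>R s *\<^sub>R (\<kappa>, - 1) \<in> sector T r X Outer_L"
        unfolding eq by fastforce
    qed
  qed
  then show ?thesis by (rule that[OF emanates_line])
qed

lemma initial_line_borders_outer_right:
  obtains v h where "emanates v h"
    "\<forall>\<^sub>F s in at_right 0. \<forall>\<theta>\<in>{0<..<1}. (1 - \<theta>) *\<^sub>R s *\<^sub>R (0, 1) + \<theta> *\<^sub>R h s \<in> sector T r X Outer_R"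
proof -
  obtain \<kappa> where \<kappa>: "\<kappa> > 0"
    "\<forall>\<^sub>F s in at_right 0. \<forall>\<theta>\<in>{0<..<1}. \<theta> * \<kappa> * s < T \<and> \<bar>X Wave6 (\<theta> * \<kappa> * s)\<bar> < s"
    by (rule wave_curve_small_slope)
  have "\<forall>\<^sub>F s in at_right 0. 0 < s \<and> s < r"
    using T_r_pos by (auto simp: eventually_at_right_field)
  with \<kappa>(2) have "\<forall>\<^sub>F s in at_right 0. \<forall>\<theta>\<in>{0<..<1}.
      (1 - \<theta>) *\<^sub>R s *\<^sub>R (0, 1) + \<theta> *\<^sub>R s *\<^sub>R (\<kappa>, 1) \<in> sector T r X Outer_R"
  proof eventually_elim
    case (elim s)
    show ?case
    proof
      fix \<theta> :: real assume \<theta>: "\<theta> \<in> {0<..<1}"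
      have eq: "(1 - \<theta>) *\<^sub>R s *\<^sub>R (0, 1) + \<theta> *\<^sub>R s *\<^sub>R (\<kappa>, 1) = (\<theta> * \<kappa> * s, s)"
        by (simp add: algebra_simps)
      have "0 < \<theta> * \<kappa> * s" using \<theta> \<kappa>(1) elim(2) by simp
      with elim \<theta> show "(1 - \<theta>) *\<^sub>R s *\<^sub>R (0, 1) + \<theta> *\<^sub>R s *\<^sub>R (\<kappa>, 1) \<in> sector T r X Outer_R"
        unfolding eq by fastforce
    qed
  qed
  then show ?thesis by (rule that[OF emanates_line])
qed

section \<open>Relations between the limits of the derivatives\<close>

lemma at_origin_within_sector_nontrivial: "at (0, 0) within sector T r X Q \<noteq> bot"
proof -
  have left: "at (0, 0) within sector T r X (left_sector w) \<noteq> bot" for w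
    by (rule wave_curve_borders_left_sector[of w])
      (rule at_corner_within_nontrivial[OF origin_notin_sector wave_curve_emanates])
  have right: "at (0, 0) within sector T r X (right_sector w) \<noteq> bot" for w
    by (rule wave_curve_borders_right_sector[of w])
      (rule at_corner_within_nontrivial[OF origin_notin_sector wave_curve_emanates])
  show ?thesis
    using left[of Wave1] left[of Wave2] left[of Contact] left[of Wave5] left[of Wave6] right[of Wave6]
    by (cases Q) auto
qed

lemma sector_directional_derivative:
  assumes "(partial_t V \<longlongrightarrow> a) (at (0, 0) within sector T r X Q)"
    and "(partial_x V \<longlongrightarrow> b) (at (0, 0) within sector T r X Q)"
    and "emanates v g" "emanates w h"
    and "\<forall>\<^sub>F s in at_right 0. \<forall>\<theta>\<in>{0<..<1}. (1 - \<theta>) *\<^sub>R g s + \<theta> *\<^sub>R h s \<in> sector T r X Q"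
    and "\<forall>\<^sub>F s in at_right 0. g s \<in> {0..<T} \<times> {-r<..<r}"
  shows "((\<lambda>s. (V (g s) - V (0, 0)) /\<^sub>R s) \<longlongrightarrow> fst v *\<^sub>R a + snd v *\<^sub>R b) (at_right 0)"
  by (rule directional_derivative_along_boundary_curve[OF open_sector[OF curves]
        origin_notin_sector V_C1 assms(1-5) V_continuous sector_subset_strip[OF curves]
        origin_in_strip assms(6)])

text \<open>
  Both sides are the derivative at \<open>t = 0\<close> of \<open>V\<close> along the curve, computed from the two adjacent
  sectors; \<open>V\<close> is continuous, so it takes the same values on the curve from both sides.
\<close>

lemma derivative_along_wave_continuous:
  assumes "(partial_t V \<longlongrightarrow> a) (at (0, 0) within sector T r X (left_sector w))"
    and "(partial_x V \<longlongrightarrow> b) (at (0, 0) within sector T r X (left_sector w))"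
    and "(partial_t V \<longlongrightarrow> a') (at (0, 0) within sector T r X (right_sector w))"
    and "(partial_x V \<longlongrightarrow> b') (at (0, 0) within sector T r X (right_sector w))"
  shows "a + char_speed w (V (0, 0)) *\<^sub>R b = a' + char_speed w (V (0, 0)) *\<^sub>R b'"
proof -
  let ?q = "\<lambda>s. (V (s, X w s) - V (0, 0)) /\<^sub>R s"
  obtain v h where "emanates v h" "\<forall>\<^sub>F s in at_right 0. \<forall>\<theta>\<in>{0<..<1}.
      (1 - \<theta>) *\<^sub>R (s, X w s) + \<theta> *\<^sub>R h s \<in> sector T r X (left_sector w)"
    by (rule wave_curve_borders_left_sector)
  from sector_directional_derivative[OF assms(1,2) wave_curve_emanates this wave_curve_in_strip]
  have l: "(?q \<longlongrightarrow> a + char_speed w (V (0, 0)) *\<^sub>R b) (at_right 0)" by simp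
  obtain v h where "emanates v h" "\<forall>\<^sub>F s in at_right 0. \<forall>\<theta>\<in>{0<..<1}.
      (1 - \<theta>) *\<^sub>R (s, X w s) + \<theta> *\<^sub>R h s \<in> sector T r X (right_sector w)"
    by (rule wave_curve_borders_right_sector)
  from sector_directional_derivative[OF assms(3,4) wave_curve_emanates this wave_curve_in_strip]
  have "(?q \<longlongrightarrow> a' + char_speed w (V (0, 0)) *\<^sub>R b') (at_right 0)" by simp
  with l show ?thesis by (intro tendsto_unique[of "at_right 0"]) auto
qed

context
  fixes VL' VR' Vs :: state
  assumes data: "GRP_initial_data Vs VL' Vs VR' V r"
begin

lemma V_origin: "V (0, 0) = Vs"
proof (rule tendsto_unique)
  have ev: "\<forall>\<^sub>F s in at_right 0. 0 < s \<and> s < r"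
    using T_r_pos by (auto simp: eventually_at_right_field)
  have "\<forall>\<^sub>F s in at_right 0. (0, s) \<in> {0..<T} \<times> {-r<..<r}"
    using ev by eventually_elim (use T_r_pos in auto)
  then show "((\<lambda>s. V (0, s)) \<longlongrightarrow> V (0, 0)) (at_right 0)"
    by (intro continuous_on_tendsto_compose[OF V_continuous _ origin_in_strip]
        tendsto_Pair tendsto_const tendsto_ident_at)
  have "((\<lambda>s. Vs + s *\<^sub>R VR') \<longlongrightarrow> Vs + 0 *\<^sub>R VR') (at_right 0)"
    by (intro tendsto_intros)
  moreover have "\<forall>\<^sub>F s in at_right 0. Vs + s *\<^sub>R VR' = V (0, s)"
    using ev by eventually_elim (use data in \<open>auto simp: GRP_initial_data_def\<close>)
  ultimately show "((\<lambda>s. V (0, s)) \<longlongrightarrow> Vs) (at_right 0)"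
    using Lim_transform_eventually by fastforce
qed auto

text \<open>
  The linear initial data fix the slope in the outer sector because the negative \<open>x\<close>-axis bounds
  that sector: the derivative along the axis is \<open>- b\<close> by the expansion inside the sector and
  \<open>- VL'\<close> by the data.
\<close>

lemma outer_left_slope:
  assumes "(partial_t V \<longlongrightarrow> a) (at (0, 0) within sector T r X Outer_L)"
    and "(partial_x V \<longlongrightarrow> b) (at (0, 0) within sector T r X Outer_L)"
  shows "b = VL'"
proof -
  have ev: "\<forall>\<^sub>F s in at_right 0. 0 < s \<and> s < r"
    using T_r_pos by (auto simp: eventually_at_right_field)
  obtain v h where "emanates v h" "\<forall>\<^sub>F s in at_right 0. \<forall>\<theta>\<in>{0<..<1}.
      (1 - \<theta>) *\<^sub>R s *\<^sub>R (0, - 1) + \<theta> *\<^sub>R h s \<in> sector T r X Outer_L"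
    by (rule initial_line_borders_outer_left)
  moreover have "\<forall>\<^sub>F s in at_right 0. s *\<^sub>R (0, - 1) \<in> {0..<T} \<times> {-r<..<r}"
    using ev by eventually_elim (use T_r_pos in auto)
  ultimately have "((\<lambda>s. (V (s *\<^sub>R (0, - 1)) - V (0, 0)) /\<^sub>R s) \<longlongrightarrow> - b) (at_right 0)"
    using sector_directional_derivative[OF assms emanates_line, of _ h "(0, - 1)"] by simp
  moreover have "((\<lambda>s. (V (s *\<^sub>R (0, - 1)) - V (0, 0)) /\<^sub>R s) \<longlongrightarrow> - VL') (at_right 0)"
  proof (rule tendsto_eventually)
    show "\<forall>\<^sub>F s in at_right 0. (V (s *\<^sub>R (0, - 1)) - V (0, 0)) /\<^sub>R s = - VL'"
      using ev
    proof eventually_elim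
      case (elim s)
      then have "V (0, - s) = Vs + (- s) *\<^sub>R VL'" using data by (auto simp: GRP_initial_data_def)
      with elim show ?case by (simp add: V_origin)
    qed
  qed
  ultimately have "- b = - VL'" by (intro tendsto_unique[of "at_right 0"]) auto
  then show ?thesis by simp
qed

lemma outer_right_slope:
  assumes "(partial_t V \<longlongrightarrow> a) (at (0, 0) within sector T r X Outer_R)"
    and "(partial_x V \<longlongrightarrow> b) (at (0, 0) within sector T r X Outer_R)"
  shows "b = VR'"
proof -
  have ev: "\<forall>\<^sub>F s in at_right 0. 0 < s \<and> s < r"
    using T_r_pos by (auto simp: eventually_at_right_field)
  obtain v h where "emanates v h" "\<forall>\<^sub>F s in at_right 0. \<forall>\<theta>\<in>{0<..<1}.
      (1 - \<theta>) *\<^sub>R s *\<^sub>R (0, 1) + \<theta> *\<^sub>R h s \<in> sector T r X Outer_R"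
    by (rule initial_line_borders_outer_right)
  moreover have "\<forall>\<^sub>F s in at_right 0. s *\<^sub>R (0, 1) \<in> {0..<T} \<times> {-r<..<r}"
    using ev by eventually_elim (use T_r_pos in auto)
  ultimately have "((\<lambda>s. (V (s *\<^sub>R (0, 1)) - V (0, 0)) /\<^sub>R s) \<longlongrightarrow> b) (at_right 0)"
    using sector_directional_derivative[OF assms emanates_line, of _ h "(0, 1)"] by simp
  moreover have "((\<lambda>s. (V (s *\<^sub>R (0, 1)) - V (0, 0)) /\<^sub>R s) \<longlongrightarrow> VR') (at_right 0)"
  proof (rule tendsto_eventually)
    show "\<forall>\<^sub>F s in at_right 0. (V (s *\<^sub>R (0, 1)) - V (0, 0)) /\<^sub>R s = VR'"
      using ev
    proof eventually_elim
      case (elim s)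
      then have "V (0, s) = Vs + s *\<^sub>R VR'" using data by (auto simp: GRP_initial_data_def)
      with elim show ?case by (simp add: V_origin)
    qed
  qed
  ultimately show ?thesis by (intro tendsto_unique[of "at_right 0"]) auto
qed

end

end
lemma bounded_linear_components:
  "bounded_linear rho" "bounded_linear u1" "bounded_linear p11"
  by (auto simp: rho_def[abs_def] u1_def[abs_def] p11_def[abs_def] bounded_linear_vec_nth)

lemma partial_bounded_linear_image:
  assumes "bounded_linear q" "C1_in S V" "z \<in> S"
  shows "partial_t (\<lambda>z. q (V z)) z = q (partial_t V z)"
    and "partial_x (\<lambda>z. q (V z)) z = q (partial_x V z)"
proof -
  have "(\<lambda>s. V (s, snd z)) differentiable (at (fst z))" "(\<lambda>y. V (fst z, y)) differentiable (at (snd z))"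
    using assms(2,3) by (auto simp: C1_in_def)
  then show "partial_t (\<lambda>z. q (V z)) z = q (partial_t V z)"
      "partial_x (\<lambda>z. q (V z)) z = q (partial_x V z)"
    unfolding partial_t_def partial_x_def
    by (auto intro!: vector_derivative_at bounded_linear.has_vector_derivative[OF assms(1)]
        simp: vector_derivative_works)
qed

lemma partial_t_component_tendsto:
  assumes "bounded_linear q" "C1_in S V" "(partial_t V \<longlongrightarrow> a) (at z0 within S)"
  shows "(partial_t (\<lambda>z. q (V z)) \<longlongrightarrow> q a) (at z0 within S)"
proof (rule Lim_transform_eventually)
  show "((\<lambda>z. q (partial_t V z)) \<longlongrightarrow> q a) (at z0 within S)"
    by (rule bounded_linear.tendsto[OF assms(1,3)])
  show "\<forall>\<^sub>F z in at z0 within S. q (partial_t V z) = partial_t (\<lambda>z. q (V z)) z"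
    using partial_bounded_linear_image(1)[OF assms(1,2)] by (auto simp: eventually_at_filter)
qed

text \<open>
  The equations for \<open>rho\<close>, \<open>u1\<close> and \<open>p11\<close>, which do not involve the other unknowns, with
  coefficients evaluated at the state \<open>v\<close> and with \<open>a\<close>, \<open>b\<close> in place of the time and space
  derivatives.
\<close>

definition acoustic_balance :: "real \<Rightarrow> state \<Rightarrow> state \<Rightarrow> state \<Rightarrow> bool" where
  "acoustic_balance Wx v a b \<longleftrightarrow>
     rho a + u1 v * rho b + rho v * u1 b = 0 \<and>
     u1 a + u1 v * u1 b + p11 b / rho v = - (1 / 2) * Wx \<and>
     p11 a + u1 v * p11 b + 3 * p11 v * u1 b = 0"

lemma acoustic_balance_at_origin:
  assumes sol: "acoustic_wave_solution W V T r X" and W: "W C1_differentiable_on UNIV"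
    and a: "(partial_t V \<longlongrightarrow> a) (at (0, 0) within sector T r X Q)"
    and b: "(partial_x V \<longlongrightarrow> b) (at (0, 0) within sector T r X Q)"
  shows "acoustic_balance (deriv W 0) (V (0, 0)) a b"
proof -
  let ?F = "at (0, 0) within sector T r X Q" and ?v = "V (0, 0)"
  have nontriv: "?F \<noteq> bot" by (rule at_origin_within_sector_nontrivial[OF sol])
  have rho0: "rho ?v \<noteq> 0"
    using V_admissible[OF sol origin_in_strip[OF sol]] by (auto simp: admissible_def)
  have "(V \<longlongrightarrow> ?v) ?F"
    using V_continuous[OF sol] origin_in_strip[OF sol] sector_subset_strip[OF curves[OF sol]]
    by (meson continuous_on_def tendsto_within_subset)
  then have V: "((\<lambda>z. q (V z)) \<longlongrightarrow> q ?v) ?F" if "bounded_linear q" for q :: "state \<Rightarrow> real"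
    using bounded_linear.tendsto[OF that] by blast
  have A: "((\<lambda>z. q (partial_t V z)) \<longlongrightarrow> q a) ?F" and B: "((\<lambda>z. q (partial_x V z)) \<longlongrightarrow> q b) ?F"
    if "bounded_linear q" for q :: "state \<Rightarrow> real"
    using bounded_linear.tendsto[OF that a] bounded_linear.tendsto[OF that b] by auto
  have "((\<lambda>z. deriv W (snd z)) \<longlongrightarrow> deriv W (snd (0::real, 0::real))) ?F"
  proof -
    have "continuous_on UNIV (deriv W)"
    proof -
      obtain D where D: "\<And>x. (W has_vector_derivative D x) (at x)" "continuous_on UNIV D"
        using W unfolding C1_differentiable_on_def by auto
      then have "deriv W = D"
        by (auto intro!: DERIV_imp_deriv simp: has_real_derivative_iff_has_vector_derivative)
      with D show ?thesis by simp
    qed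
    then show ?thesis
      by (intro continuous_on_tendsto_compose[of UNIV "deriv W"] tendsto_snd tendsto_ident_at) auto
  qed
  then have dW: "((\<lambda>z. deriv W (snd z)) \<longlongrightarrow> deriv W 0) ?F" by simp
  have pde: "rho (partial_t V z) + u1 (V z) * rho (partial_x V z) + rho (V z) * u1 (partial_x V z) = 0"
      "u1 (partial_t V z) + u1 (V z) * u1 (partial_x V z) + p11 (partial_x V z) / rho (V z)
        = - (1 / 2) * deriv W (snd z)"
      "p11 (partial_t V z) + u1 (V z) * p11 (partial_x V z) + 3 * p11 (V z) * u1 (partial_x V z) = 0"
    if z: "z \<in> sector T r X Q" for z
  proof -
    have "ten_moment_at W V z" using sol z by (simp add: acoustic_wave_solution_def)
    then show "rho (partial_t V z) + u1 (V z) * rho (partial_x V z) + rho (V z) * u1 (partial_x V z) = 0"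
      "u1 (partial_t V z) + u1 (V z) * u1 (partial_x V z) + p11 (partial_x V z) / rho (V z)
        = - (1 / 2) * deriv W (snd z)"
      "p11 (partial_t V z) + u1 (V z) * p11 (partial_x V z) + 3 * p11 (V z) * u1 (partial_x V z) = 0"
      unfolding ten_moment_at_def material_def Let_def
      by (simp_all add: partial_bounded_linear_image[OF _ V_C1[OF sol] z] bounded_linear_components)
  qed
  note lims = bounded_linear_components[THEN V] bounded_linear_components[THEN A]
    bounded_linear_components[THEN B]
  have limit_eq: "l = m" if "(f \<longlongrightarrow> l) ?F" "(g \<longlongrightarrow> m) ?F" "\<And>z. z \<in> sector T r X Q \<Longrightarrow> f z = g z"
    for l m :: real and f g
  proof (rule tendsto_unique[OF nontriv that(1)])
    show "(f \<longlongrightarrow> m) ?F"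
      using that(2,3) by (subst tendsto_cong[of f g]) (auto simp: eventually_at_filter)
  qed
  have "rho a + u1 ?v * rho b + rho ?v * u1 b = 0"
    by (rule limit_eq[OF _ tendsto_const pde(1)])
      (intro tendsto_add tendsto_mult; rule lims)
  moreover have "u1 a + u1 ?v * u1 b + p11 b / rho ?v = - (1 / 2) * deriv W 0"
    by (rule limit_eq[OF _ _ pde(2)])
      (intro tendsto_add tendsto_mult tendsto_divide tendsto_const dW rho0; rule lims)+
  moreover have "p11 a + u1 ?v * p11 b + 3 * p11 ?v * u1 b = 0"
    by (rule limit_eq[OF _ tendsto_const pde(3)])
      (intro tendsto_add tendsto_mult tendsto_const; rule lims)
  ultimately show ?thesis by (simp add: acoustic_balance_def)
qed

section \<open>Which derivatives a wave can change\<close>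

text \<open>
  Continuity of the derivative along the wave turns a jump of the time derivative into \<open>- \<sigma>\<close> times
  the jump of the space derivative. Subtracting the equations on the two sides, the source
  cancels, and what is left are the eigenvector equations for the eigenvalue \<open>\<sigma>\<close>, satisfied by the
  jumps of the space derivatives.
\<close>

lemma jump_relations:
  assumes "acoustic_balance Wx v a b" "acoustic_balance Wx v a' b'"
    and "a + \<sigma> *\<^sub>R b = a' + \<sigma> *\<^sub>R b'" and "rho v > 0"
  shows "p11 b - p11 b' = rho v * (\<sigma> - u1 v) * (u1 b - u1 b')"
    and "(\<sigma> - u1 v) * (p11 b - p11 b') = 3 * p11 v * (u1 b - u1 b')"
    and "(\<sigma> - u1 v) * (rho b - rho b') = rho v * (u1 b - u1 b')"
proof -
  have kink: "q a + \<sigma> * q b = q a' + \<sigma> * q b'" if "bounded_linear q" for q :: "state \<Rightarrow> real"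
  proof -
    interpret bounded_linear q by fact
    have "q (a + \<sigma> *\<^sub>R b) = q (a' + \<sigma> *\<^sub>R b')" using assms(3) by simp
    then show ?thesis by (simp add: add scale)
  qed
  note k = kink[OF bounded_linear_components(1)] kink[OF bounded_linear_components(2)]
    kink[OF bounded_linear_components(3)]
  have "p11 b / rho v - p11 b' / rho v = (\<sigma> - u1 v) * (u1 b - u1 b')"
    using assms(1,2) k(2) by (simp add: acoustic_balance_def algebra_simps)
  then show "p11 b - p11 b' = rho v * (\<sigma> - u1 v) * (u1 b - u1 b')"
    using assms(4) by (simp add: field_simps)
  show "(\<sigma> - u1 v) * (p11 b - p11 b') = 3 * p11 v * (u1 b - u1 b')"
    "(\<sigma> - u1 v) * (rho b - rho b') = rho v * (u1 b - u1 b')"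
    using assms(1,2) k(1,3) by (simp_all add: acoustic_balance_def algebra_simps)
qed

text \<open>
  In the block for \<open>u1\<close> and \<open>p11\<close> the only eigenvalues are \<open>u1 \<plusminus> c\<close> with \<open>rho * c\<^sup>2 = 3 * p11\<close>; at
  every other speed the eigenvector relations force the jumps to vanish.
\<close>

lemma non_sonic_wave_preserves_u1_p11:
  assumes "acoustic_balance Wx v a b" "acoustic_balance Wx v a' b'"
    and "a + \<sigma> *\<^sub>R b = a' + \<sigma> *\<^sub>R b'" and "rho v > 0"
    and "rho v * (\<sigma> - u1 v)\<^sup>2 \<noteq> 3 * p11 v"
  shows "u1 b = u1 b'" "p11 b = p11 b'" "u1 a = u1 a'" "p11 a = p11 a'"
proof -
  note j = jump_relations[OF assms(1-4)]
  have "(rho v * (\<sigma> - u1 v)\<^sup>2 - 3 * p11 v) * (u1 b - u1 b') = 0"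
    using j(1,2) by algebra
  then show u: "u1 b = u1 b'" using assms(5) by simp
  then show p: "p11 b = p11 b'" using j(1) by simp
  show "u1 a = u1 a'" "p11 a = p11 a'"
    using assms(1,2) u p by (auto simp: acoustic_balance_def)
qed

text \<open>
  The combination \<open>p11 - c\<^sup>2 * rho\<close>, with \<open>c\<^sup>2 = 3 * p11 / rho\<close> held fixed, is the linearized
  entropy. It is transported with speed \<open>u1\<close>, so only a wave of that speed can carry a jump of
  its slope.
\<close>

lemma entropy_slope_changes_only_at_contact:
  assumes "acoustic_balance Wx v a b" "acoustic_balance Wx v a' b'"
    and "a + \<sigma> *\<^sub>R b = a' + \<sigma> *\<^sub>R b'" and "rho v > 0"
    and "\<sigma> \<noteq> u1 v"
  shows "p11 b - 3 * p11 v / rho v * rho b = p11 b' - 3 * p11 v / rho v * rho b'"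
proof -
  note j = jump_relations[OF assms(1-4)]
  have "(\<sigma> - u1 v) * (rho v * (p11 b - p11 b') - 3 * p11 v * (rho b - rho b')) = 0"
    using j(2,3) by algebra
  then have "rho v * (p11 b - p11 b') = 3 * p11 v * (rho b - rho b')"
    using assms(5) by simp
  then show ?thesis using assms(4) by (simp add: field_simps)
qed

lemma entropy_transport:
  assumes "acoustic_balance Wx v a b" "rho v > 0"
  shows "p11 a - 3 * p11 v / rho v * rho a = - u1 v * (p11 b - 3 * p11 v / rho v * rho b)"
proof -
  have p: "p11 a = - u1 v * p11 b - 3 * p11 v * u1 b" and rho: "rho a = - u1 v * rho b - rho v * u1 b"
    using assms(1) by (auto simp: acoustic_balance_def)
  show ?thesis unfolding p rho using assms(2) by (simp add: field_simps)
qed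

section \<open>The time derivatives in the fan\<close>

theorem theorem5p25:
  fixes W :: "real \<Rightarrow> real"
    and V :: "real \<times> real \<Rightarrow> state"
    and VL VL' VR VR' Vs :: state
    and X :: "wave \<Rightarrow> real \<Rightarrow> real"
    and T r c :: real
  assumes "W C1_differentiable_on UNIV"
    and "VL = Vs" and "VR = Vs" and "VL' \<noteq> VR'"
    and "admissible Vs"
    and "c = sound_speed Vs"
    and "GRP_initial_data VL VL' VR VR' V r"
    and "acoustic_wave_solution W V T r X"
  shows "\<exists>u1t p11t rhotL rhotR.
    (\<forall>Q\<in>{Star_L, StarStar_L, StarStar_R, Star_R}.
       (partial_t (\<lambda>z. u1 (V z)) \<longlongrightarrow> u1t) (at (0, 0) within sector T r X Q) \<and>
       (partial_t (\<lambda>z. p11 (V z)) \<longlongrightarrow> p11t) (at (0, 0) within sector T r X Q)) \<and>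
    (\<forall>Q\<in>{Star_L, StarStar_L}.
       (partial_t (\<lambda>z. rho (V z)) \<longlongrightarrow> rhotL) (at (0, 0) within sector T r X Q)) \<and>
    (\<forall>Q\<in>{StarStar_R, Star_R}.
       (partial_t (\<lambda>z. rho (V z)) \<longlongrightarrow> rhotR) (at (0, 0) within sector T r X Q)) \<and>
    u1t = 1 / (2 * c) *
       ((- (p11 VL' / rho Vs) - c * u1 VL' - 1 / 2 * deriv W 0) * (u1 Vs + c) +
        (p11 VR' / rho Vs - c * u1 VR' + 1 / 2 * deriv W 0) * (u1 Vs - c)) \<and>
    p11t = - (rho Vs * c / 2) *
       ((u1 VL' + p11 VL' / (rho Vs * c)) * (u1 Vs + c) -
        (u1 VR' - p11 VR' / (rho Vs * c)) * (u1 Vs - c)) \<and>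
    rhotL = 1 / c\<^sup>2 * (p11t + u1 Vs * (p11 VL' - c\<^sup>2 * rho VL')) \<and>
    rhotR = 1 / c\<^sup>2 * (p11t + u1 Vs * (p11 VR' - c\<^sup>2 * rho VR'))"
proof -
  note sol = assms(8)
  have data: "GRP_initial_data Vs VL' Vs VR' V r" using assms by simp
  have V0: "V (0, 0) = Vs" by (rule V_origin[OF sol data])
  have rho: "rho Vs > 0" and p: "p11 Vs > 0" using assms(5) by (auto simp: admissible_def)
  have c: "c > 0" and c2: "c\<^sup>2 = 3 * p11 Vs / rho Vs"
    using assms(6) rho p by (auto simp: sound_speed_def)
  have rc2: "rho Vs * c\<^sup>2 = 3 * p11 Vs" using c2 rho by simp
  have "\<forall>Q. \<exists>ab. (partial_t V \<longlongrightarrow> fst ab) (at (0, 0) within sector T r X Q) \<and>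
      (partial_x V \<longlongrightarrow> snd ab) (at (0, 0) within sector T r X Q)"
    using sol unfolding acoustic_wave_solution_def by (metis fst_conv snd_conv)
  then obtain ab where
    "\<And>Q. (partial_t V \<longlongrightarrow> fst (ab Q)) (at (0, 0) within sector T r X Q) \<and>
        (partial_x V \<longlongrightarrow> snd (ab Q)) (at (0, 0) within sector T r X Q)"
    by metis
  then obtain a b where
    a: "\<And>Q. (partial_t V \<longlongrightarrow> a Q) (at (0, 0) within sector T r X Q)" and
    b: "\<And>Q. (partial_x V \<longlongrightarrow> b Q) (at (0, 0) within sector T r X Q)"
    using that[of "\<lambda>Q. fst (ab Q)" "\<lambda>Q. snd (ab Q)"] by blast
  have bal: "acoustic_balance (deriv W 0) Vs (a Q) (b Q)" for Q
    using acoustic_balance_at_origin[OF sol assms(1) a b] by (simp add: V0)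
  have kink: "a (left_sector w) + char_speed w Vs *\<^sub>R b (left_sector w) =
      a (right_sector w) + char_speed w Vs *\<^sub>R b (right_sector w)" for w
    using derivative_along_wave_continuous[OF sol a b a b] by (simp add: V0)
  have outer: "b Outer_L = VL'" "b Outer_R = VR'"
    using outer_left_slope[OF sol data a b] outer_right_slope[OF sol data a b] .
  \<comment> \<open>The speeds of the three inner waves relative to \<open>u1\<close> are \<open>0\<close> and \<open>\<plusminus> c / sqrt 3\<close>.\<close>
  have slow: "u1 (b (left_sector w)) = u1 (b (right_sector w)) \<and>
      p11 (b (left_sector w)) = p11 (b (right_sector w)) \<and>
      u1 (a (left_sector w)) = u1 (a (right_sector w)) \<and>
      p11 (a (left_sector w)) = p11 (a (right_sector w))"
    if "w \<in> {Wave2, Contact, Wave5}" for w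
  proof -
    have "(char_speed w Vs - u1 Vs)\<^sup>2 = 0 \<or> (char_speed w Vs - u1 Vs)\<^sup>2 = c\<^sup>2 / 3"
      using that assms(6) by (auto simp: power_divide)
    then have "rho Vs * (char_speed w Vs - u1 Vs)\<^sup>2 \<noteq> 3 * p11 Vs"
    proof (elim disjE)
      assume "(char_speed w Vs - u1 Vs)\<^sup>2 = c\<^sup>2 / 3"
      then have "rho Vs * (char_speed w Vs - u1 Vs)\<^sup>2 = rho Vs * c\<^sup>2 / 3"
        by (simp only: times_divide_eq_right)
      then have "rho Vs * (char_speed w Vs - u1 Vs)\<^sup>2 = p11 Vs" using rc2 by simp
      then show ?thesis using p by simp
    qed (use p in simp)
    from non_sonic_wave_preserves_u1_p11[OF bal bal kink rho this] show ?thesis by simp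
  qed
  note star = slow[of Wave2, simplified] slow[of Contact, simplified] slow[of Wave5, simplified]
  have entropy: "p11 (b (left_sector w)) - c\<^sup>2 * rho (b (left_sector w)) =
      p11 (b (right_sector w)) - c\<^sup>2 * rho (b (right_sector w))" if "w \<noteq> Contact" for w
  proof -
    have "char_speed w Vs \<noteq> u1 Vs" using that c assms(6) by (cases w) auto
    from entropy_slope_changes_only_at_contact[OF bal bal kink rho this] show ?thesis by (simp add: c2)
  qed
  \<comment> \<open>The common slopes of \<open>u1\<close> and \<open>p11\<close> in the fan solve two linear equations, one from each of
    the outermost waves.\<close>
  define ux px where "ux = u1 (b Star_L)" and "px = p11 (b Star_L)"
  have ux_R: "u1 (b Star_R) = ux" and px_R: "p11 (b Star_R) = px"
    using star by (auto simp: ux_def px_def)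
  have L: "p11 VL' - px = - rho Vs * c * (u1 VL' - ux)"
    using jump_relations(1)[OF bal bal kink[of Wave1] rho] assms(6)
    by (simp add: outer ux_def px_def)
  have R: "px - p11 VR' = rho Vs * c * (ux - u1 VR')"
    using jump_relations(1)[OF bal bal kink[of Wave6] rho] assms(6)
    by (simp add: outer ux_R px_R)
  have ux: "2 * rho Vs * c * ux = rho Vs * c * (u1 VL' + u1 VR') + p11 VL' - p11 VR'"
    using L R by (simp add: algebra_simps)
  have px: "2 * px = p11 VL' + p11 VR' + rho Vs * c * (u1 VL' - u1 VR')"
    using L R by (simp add: algebra_simps)
  have ux': "ux = (u1 VL' + u1 VR') / 2 + (p11 VL' - p11 VR') / (2 * rho Vs * c)"
    using ux rho c by (simp add: field_simps)
  have px': "px = (p11 VL' + p11 VR' + rho Vs * c * (u1 VL' - u1 VR')) / 2"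
    using px by simp
  have u1t: "u1 (a Star_L) = 1 / (2 * c) *
       ((- (p11 VL' / rho Vs) - c * u1 VL' - 1 / 2 * deriv W 0) * (u1 Vs + c) +
        (p11 VR' / rho Vs - c * u1 VR' + 1 / 2 * deriv W 0) * (u1 Vs - c))"
  proof -
    have "u1 (a Star_L) = - u1 Vs * ux - px / rho Vs - deriv W 0 / 2"
      using bal[of Star_L] by (simp add: acoustic_balance_def ux_def px_def)
    then show ?thesis using rho c unfolding ux' px' by (simp add: field_simps)
  qed
  have p11t: "p11 (a Star_L) = - (rho Vs * c / 2) *
       ((u1 VL' + p11 VL' / (rho Vs * c)) * (u1 Vs + c) -
        (u1 VR' - p11 VR' / (rho Vs * c)) * (u1 Vs - c))"
  proof -
    define sL sR where "sL = u1 VL' + p11 VL' / (rho Vs * c)"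
      and "sR = u1 VR' - p11 VR' / (rho Vs * c)"
    have "p11 (a Star_L) = - u1 Vs * px - rho Vs * c\<^sup>2 * ux"
      using bal[of Star_L] rc2 by (simp add: acoustic_balance_def ux_def px_def)
    then have "2 * p11 (a Star_L) = - u1 Vs * (2 * px) - c * (2 * rho Vs * c * ux)"
      by (simp add: power2_eq_square)
    also have "\<dots> = - (rho Vs * c * u1 VL' + p11 VL') * (u1 Vs + c)
        + (rho Vs * c * u1 VR' - p11 VR') * (u1 Vs - c)"
      unfolding ux px by (simp add: algebra_simps)
    also have "rho Vs * c * u1 VL' + p11 VL' = rho Vs * c * sL"
      using rho c by (simp add: sL_def field_simps)
    also have "rho Vs * c * u1 VR' - p11 VR' = rho Vs * c * sR"
      using rho c by (simp add: sR_def field_simps)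
    finally have "2 * p11 (a Star_L) = - (rho Vs * c) * (sL * (u1 Vs + c) - sR * (u1 Vs - c))"
      by (simp add: algebra_simps)
    then have "p11 (a Star_L) = - (rho Vs * c / 2) * (sL * (u1 Vs + c) - sR * (u1 Vs - c))"
      by simp
    then show ?thesis by (simp only: sL_def sR_def)
  qed
  have rhot: "rho (a Q) = 1 / c\<^sup>2 * (p11 (a Star_L) + u1 Vs * (p11 d - c\<^sup>2 * rho d))"
    if "p11 (a Q) = p11 (a Star_L)" "p11 (b Q) - c\<^sup>2 * rho (b Q) = p11 d - c\<^sup>2 * rho d" for Q d
  proof -
    have "p11 (a Star_L) - c\<^sup>2 * rho (a Q) = - u1 Vs * (p11 d - c\<^sup>2 * rho d)"
      using entropy_transport[OF bal rho, of Q] that by (simp add: c2)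
    then have "c\<^sup>2 * rho (a Q) = p11 (a Star_L) + u1 Vs * (p11 d - c\<^sup>2 * rho d)"
      by (simp add: algebra_simps)
    then show ?thesis using c by (simp add: field_simps)
  qed
  have rhoL: "rho (a Q) = 1 / c\<^sup>2 * (p11 (a Star_L) + u1 Vs * (p11 VL' - c\<^sup>2 * rho VL'))"
    if "Q \<in> {Star_L, StarStar_L}" for Q
    using that entropy[of Wave1] entropy[of Wave2] star outer by (intro rhot) auto
  have rhoR: "rho (a Q) = 1 / c\<^sup>2 * (p11 (a Star_L) + u1 Vs * (p11 VR' - c\<^sup>2 * rho VR'))"
    if "Q \<in> {StarStar_R, Star_R}" for Q
    using that entropy[of Wave6] entropy[of Wave5] star outer by (intro rhot) auto
  have u1p11: "u1 (a Q) = u1 (a Star_L)" "p11 (a Q) = p11 (a Star_L)"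
    if "Q \<in> {Star_L, StarStar_L, StarStar_R, Star_R}" for Q
    using that star by auto
  note limit = partial_t_component_tendsto[OF _ V_C1[OF sol] a]
  have lim: "(partial_t (\<lambda>z. u1 (V z)) \<longlongrightarrow> u1 (a Q)) (at (0, 0) within sector T r X Q)"
      "(partial_t (\<lambda>z. p11 (V z)) \<longlongrightarrow> p11 (a Q)) (at (0, 0) within sector T r X Q)"
      "(partial_t (\<lambda>z. rho (V z)) \<longlongrightarrow> rho (a Q)) (at (0, 0) within sector T r X Q)" for Q
    by (intro limit bounded_linear_components)+
  show ?thesis
  proof (intro exI conjI ballI)
    fix Q assume Q: "Q \<in> {Star_L, StarStar_L, StarStar_R, Star_R}"
    show "(partial_t (\<lambda>z. u1 (V z)) \<longlongrightarrow> u1 (a Star_L)) (at (0, 0) within sector T r X Q)"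
      "(partial_t (\<lambda>z. p11 (V z)) \<longlongrightarrow> p11 (a Star_L)) (at (0, 0) within sector T r X Q)"
      using lim(1,2)[of Q] u1p11[OF Q] by simp_all
  next
    fix Q assume "Q \<in> {Star_L, StarStar_L}"
    from rhoL[OF this] lim(3)[of Q]
    show "(partial_t (\<lambda>z. rho (V z)) \<longlongrightarrow> 1 / c\<^sup>2 * (p11 (a Star_L) + u1 Vs * (p11 VL' - c\<^sup>2 * rho VL')))
        (at (0, 0) within sector T r X Q)" by simp
  next
    fix Q assume "Q \<in> {StarStar_R, Star_R}"
    from rhoR[OF this] lim(3)[of Q]
    show "(partial_t (\<lambda>z. rho (V z)) \<longlongrightarrow> 1 / c\<^sup>2 * (p11 (a Star_L) + u1 Vs * (p11 VR' - c\<^sup>2 * rho VR')))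
        (at (0, 0) within sector T r X Q)" by simp
  qed (rule u1t p11t refl)+
qed

end
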